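(* Let $A, B \subset \mathbb{R}^n$ be non-empty compact sets and let a uniform grid with spacing $h>0$, grid point set $N$ and cell set $C$ be given which covers $A \cup B$. For a grid point $x \in N$ and arbitrary $y \in \mathbb{R}^n$ set $$t(x,y) = \begin{cases} |x-y| & \text{if } x \in A,\\ 2|x-y| & \text{if } x \notin A.\end{cases}$$ For a cell $c \in C$ define $$\overline{d}(c) = \sup_{y \in \mathrm{co}(N(c))} \ \min_{x \in N(c)} \Big( |d_A(x) - d_B(x)| + t(x,y) \Big).$$ Then $$d(A \to B) \le \max_{c \in C'(A)} \overline{d}(c), \qquad \text{where } C'(A) = \{ c \in C : \mathrm{co}(N(c)) \cap A \neq \emptyset \}.$$ Similarly, $d(B \to A)$ (and thus $d_H(A,B)$) can be estimated: the same inequality holds with the roles of $A$ and $B$ interchanged throughout (in particular also in the definition of $t$, and with $C'(B)$ in place of $C'(A)$).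
   Context: $|\cdot|$ is the Euclidean norm on $\mathbb{R}^n$. For a set $\Omega \subset \mathbb{R}^n$, the distance function is $d_\Omega(x) = \inf_{y \in \Omega} |x-y|$. The one-sided Hausdorff distance is $d(A \to B) = \sup_{x \in A} \inf_{y \in B} |x-y|$ and the Hausdorff distance is $d_H(A,B) = \max(d(A \to B), d(B \to A))$. Grid: a bounded rectangular grid in $\mathbb{R}^n$ with uniform spacing $h>0$ in each dimension, i.e. $N = \{p + h j : j \in \mathbb{Z}^n,\ 0 \le j_i \le K_i \text{ for } i=1,\dots,n\}$ for some $p \in \mathbb{R}^n$ and integers $K_i \ge 1$, is the finite set of grid points. $C$ is the finite set of grid cells; for $c \in C$, $N(c) \subset N$ is the set of the $2^n$ grid points that are the corners of the cell $c$ (a cube of side length $h$), and $\mathrm{co}(N(c))$ is their convex hull. The grid covers $A\cup B$ if for each $y \in A \cup B$ there is $c \in C$ with $y \in \mathrm{co}(N(c))$. *)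

theory Defs
  imports "HOL-Analysis.Analysis"
begin

definition directed_hausdorff :: "'a::metric_space set \<Rightarrow> 'a set \<Rightarrow> real" where
  "directed_hausdorff A B = (SUP x\<in>A. INF y\<in>B. dist x y)"

definition hausdorff_dist :: "'a::metric_space set \<Rightarrow> 'a set \<Rightarrow> real" where
  "hausdorff_dist A B = max (directed_hausdorff A B) (directed_hausdorff B A)"

definition grid_point :: "real ^ 'n \<Rightarrow> real \<Rightarrow> int ^ 'n \<Rightarrow> real ^ 'n" where
  "grid_point p h j = p + h *\<^sub>R (\<chi> i. of_int (j $ i))"

definition grid_points :: "real ^ 'n \<Rightarrow> real \<Rightarrow> int ^ 'n \<Rightarrow> (real ^ 'n) set" where
  "grid_points p h K = {grid_point p h j | j. \<forall>i. 0 \<le> j $ i \<and> j $ i \<le> K $ i}"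

text \<open>A cell is represented by the multi-index of its lowest corner, so the cells of
  the grid with \<^term>\<open>K $ i\<close> cells in direction \<^term>\<open>i\<close> are the
  multi-indices \<^term>\<open>c\<close> with \<^prop>\<open>0 \<le> c $ i \<and> c $ i < K $ i\<close>.\<close>

definition grid_cells :: "int ^ 'n \<Rightarrow> (int ^ 'n) set" where
  "grid_cells K = {c. \<forall>i. 0 \<le> c $ i \<and> c $ i < K $ i}"

definition cell_corners :: "real ^ 'n \<Rightarrow> real \<Rightarrow> int ^ 'n \<Rightarrow> (real ^ 'n) set" where
  "cell_corners p h c = {grid_point p h (c + e) | e. \<forall>i. e $ i \<in> {0, 1}}"

definition grid_covers :: "real ^ 'n \<Rightarrow> real \<Rightarrow> int ^ 'n \<Rightarrow> (real ^ 'n) set \<Rightarrow> bool" where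
  "grid_covers p h K S \<longleftrightarrow> (\<forall>y\<in>S. \<exists>c\<in>grid_cells K. y \<in> convex hull (cell_corners p h c))"

definition cells_meeting ::
    "real ^ 'n \<Rightarrow> real \<Rightarrow> int ^ 'n \<Rightarrow> (real ^ 'n) set \<Rightarrow> (int ^ 'n) set" where
  "cells_meeting p h K A = {c \<in> grid_cells K. convex hull (cell_corners p h c) \<inter> A \<noteq> {}}"

definition corner_penalty :: "(real ^ 'n) set \<Rightarrow> real ^ 'n \<Rightarrow> real ^ 'n \<Rightarrow> real" where
  "corner_penalty A x y = (if x \<in> A then norm (x - y) else 2 * norm (x - y))"

text \<open>Only the first set enters the penalty, so the bound is not symmetric in
  \<^term>\<open>A\<close> and \<^term>\<open>B\<close>.\<close>

definition cell_bound ::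
    "real ^ 'n \<Rightarrow> real \<Rightarrow> (real ^ 'n) set \<Rightarrow> (real ^ 'n) set \<Rightarrow> int ^ 'n \<Rightarrow> real" where
  "cell_bound p h A B c =
     (SUP y \<in> convex hull (cell_corners p h c).
        MIN x \<in> cell_corners p h c. \<bar>infdist x A - infdist x B\<bar> + corner_penalty A x y)"

text \<open>\<^const>\<open>Max\<close> and \<^const>\<open>Min\<close> are unspecified on infinite and on empty
  sets; the sets they are applied to here are finite and non-empty.\<close>

lemma finite_vec_box: "finite {c :: int ^ 'n. \<forall>i. c $ i \<in> S}" if "finite S"
proof -
  have "{c :: int ^ 'n. \<forall>i. c $ i \<in> S} \<subseteq> vec_lambda ` (UNIV \<rightarrow>\<^sub>E S)"
  proof
    fix c :: "int ^ 'n"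
    assume "c \<in> {c. \<forall>i. c $ i \<in> S}"
    then have "vec_nth c \<in> UNIV \<rightarrow>\<^sub>E S" by auto
    then show "c \<in> vec_lambda ` (UNIV \<rightarrow>\<^sub>E S)"
      by (metis imageI vec_nth_inverse)
  qed
  moreover have "finite (UNIV \<rightarrow>\<^sub>E S :: ('n \<Rightarrow> int) set)"
    using that by (simp add: finite_PiE)
  ultimately show ?thesis by (meson finite_imageI finite_subset)
qed

lemma finite_grid_cells: "finite (grid_cells (K :: int ^ 'n))"
proof -
  have "grid_cells K \<subseteq> {c. \<forall>i. c $ i \<in> (\<Union>i. {0..<K $ i})}"
    unfolding grid_cells_def by auto
  then show ?thesis by (rule finite_subset) (intro finite_vec_box, simp)
qed

lemma finite_cells_meeting: "finite (cells_meeting p h K A)"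
  unfolding cells_meeting_def by (simp add: finite_grid_cells)

lemma finite_cell_corners: "finite (cell_corners p h (c :: int ^ 'n))"
proof -
  have "cell_corners p h c = (\<lambda>e. grid_point p h (c + e)) ` {e. \<forall>i. e $ i \<in> {0, 1}}"
    unfolding cell_corners_def by auto
  then show ?thesis by (auto simp only: finite.intros intro!: finite_imageI finite_vec_box)
qed

lemma cell_corners_nonempty: "cell_corners p h c \<noteq> {}"
proof -
  have "grid_point p h (c + 0) \<in> cell_corners p h c"
    unfolding cell_corners_def by (intro CollectI exI[of _ 0]) simp
  then show ?thesis by blast
qed

lemma cells_meeting_nonempty:
  assumes "grid_covers p h K S" "A \<subseteq> S" "A \<noteq> {}"
  shows "cells_meeting p h K A \<noteq> {}"
  using assms unfolding grid_covers_def cells_meeting_def by blast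

lemma grid_points_eq_corners:
  assumes K: "\<forall>i. K $ i \<ge> 1"
  shows "grid_points p h K = (\<Union>c\<in>grid_cells K. cell_corners p h c)"
proof (intro subset_antisym subsetI)
  fix x assume "x \<in> grid_points p h K"
  then obtain j where j: "x = grid_point p h j" "\<And>i. 0 \<le> j $ i \<and> j $ i \<le> K $ i"
    unfolding grid_points_def by blast
  define e :: "int ^ 'a" where "e = (\<chi> i. if j $ i = K $ i then 1 else 0)"
  have ji: "\<And>i. j $ i - e $ i < K $ i" "\<And>i. 0 \<le> j $ i - e $ i"
    using j(2) K unfolding e_def by (auto simp: order.strict_iff_order)
  then have "j - e \<in> grid_cells K"
    unfolding grid_cells_def by simp
  moreover have "x \<in> cell_corners p h (j - e)"
    unfolding cell_corners_def j(1) by (intro CollectI exI[of _ e]) (simp add: e_def)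
  ultimately show "x \<in> (\<Union>c\<in>grid_cells K. cell_corners p h c)" by blast
next
  fix x assume "x \<in> (\<Union>c\<in>grid_cells K. cell_corners p h c)"
  then obtain c e where c: "\<And>i. 0 \<le> c $ i \<and> c $ i < K $ i"
    and e: "\<And>i. e $ i = 0 \<or> e $ i = 1" and x: "x = grid_point p h (c + e)"
    unfolding grid_cells_def cell_corners_def by auto
  have "0 \<le> (c + e) $ i \<and> (c + e) $ i \<le> K $ i" for i
    using c[of i] e[of i] by auto
  then show "x \<in> grid_points p h K" unfolding grid_points_def x by blast
qed

end

theory Submission
  imports Defs
begin

text \<open>Both distance functions are 1-Lipschitz, so a point \<open>y\<close> of \<open>A\<close> and any corner \<open>x\<close> of a
  cell containing \<open>y\<close> satisfy
  \<open>d\<^sub>B(y) \<le> d\<^sub>B(x) + |x - y| \<le> |d\<^sub>A(x) - d\<^sub>B(x)| + d\<^sub>A(x) + |x - y|\<close>, where \<open>d\<^sub>A(x)\<close> vanishes if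
  \<open>x \<in> A\<close> and is at most \<open>|x - y|\<close> otherwise.\<close>

lemma infdist_le_corner_penalty:
  fixes A B :: "(real ^ 'n) set"
  assumes "y \<in> A"
  shows "infdist y B \<le> \<bar>infdist x A - infdist x B\<bar> + corner_penalty A x y"
proof -
  have "infdist y B \<le> infdist x B + norm (x - y)"
    using infdist_triangle[of y B x] by (simp add: dist_norm norm_minus_commute)
  moreover have "infdist x A \<le> norm (x - y)"
    using infdist_le[OF assms, of x] by (simp add: dist_norm)
  ultimately show ?thesis
    unfolding corner_penalty_def by auto
qed

text \<open>A real \<open>SUP\<close> dominates its members only when the family is bounded above.
  Here the minimum is at most its value at one fixed corner, and that value stays bounded as
  \<open>y\<close> ranges over the bounded hull.\<close>

lemma cell_bound_bdd_above:
  fixes A B :: "(real ^ 'n) set"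
  shows "bdd_above ((\<lambda>y. MIN x \<in> cell_corners p h c.
    \<bar>infdist x A - infdist x B\<bar> + corner_penalty A x y) ` (convex hull (cell_corners p h c)))"
proof -
  obtain x where x: "x \<in> cell_corners p h c"
    using cell_corners_nonempty by blast
  have "bounded (convex hull (cell_corners p h c))"
    by (simp add: finite_cell_corners finite_imp_bounded bounded_convex_hull)
  then obtain M where M: "\<And>y. y \<in> convex hull (cell_corners p h c) \<Longrightarrow> dist x y \<le> M"
    unfolding bounded_any_center[where a = x] by blast
  show ?thesis
  proof (rule bdd_aboveI2)
    fix y assume "y \<in> convex hull (cell_corners p h c)"
    then have "norm (x - y) \<le> M"
      using M by (simp add: dist_norm)
    \<comment> \<open>The bound must cover both branches of the penalty; if
      \<open>x \<in> A\<close>, passing from \<open>M\<close> to \<open>2 * M\<close> uses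
      \<open>0 \<le> norm (x - y) \<le> M\<close>.\<close>
    then have "corner_penalty A x y \<le> 2 * M"
      using norm_ge_zero[of "x - y"] unfolding corner_penalty_def by (auto simp del: norm_ge_zero)
    moreover have "(MIN x \<in> cell_corners p h c. \<bar>infdist x A - infdist x B\<bar> + corner_penalty A x y)
        \<le> \<bar>infdist x A - infdist x B\<bar> + corner_penalty A x y"
      using x by (intro Min_le) (auto simp: finite_cell_corners)
    ultimately show "(MIN x \<in> cell_corners p h c.
        \<bar>infdist x A - infdist x B\<bar> + corner_penalty A x y)
        \<le> \<bar>infdist x A - infdist x B\<bar> + 2 * M"
      by linarith
  qed
qed

text \<open>The corner estimate holds for every corner, so it survives the minimum; \<open>y\<close>
  itself then competes in the supremum over the hull.\<close>

lemma infdist_le_cell_bound: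
  fixes A B :: "(real ^ 'n) set"
  assumes "y \<in> A" "y \<in> convex hull (cell_corners p h c)"
  shows "infdist y B \<le> cell_bound p h A B c"
proof -
  have "infdist y B \<le> (MIN x \<in> cell_corners p h c.
      \<bar>infdist x A - infdist x B\<bar> + corner_penalty A x y)"
    using infdist_le_corner_penalty[OF assms(1)]
    by (subst Min_ge_iff) (auto simp: finite_cell_corners cell_corners_nonempty)
  also have "\<dots> \<le> cell_bound p h A B c"
    unfolding cell_bound_def by (rule cSUP_upper[OF assms(2) cell_bound_bdd_above])
  finally show ?thesis .
qed

text \<open>A cell whose hull contains \<open>y \<in> A\<close> meets \<open>A\<close> at
  \<open>y\<close>, so it is among the cells over which the maximum is taken.\<close>

lemma directed_hausdorff_le_Max_cell_bound:
  fixes A B :: "(real ^ 'n) set"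
  assumes "A \<noteq> {}" "B \<noteq> {}" "grid_covers p h K A"
  shows "directed_hausdorff A B \<le> (MAX c \<in> cells_meeting p h K A. cell_bound p h A B c)"
  unfolding directed_hausdorff_def
proof (rule cSUP_least[OF assms(1)])
  fix y assume y: "y \<in> A"
  then obtain c where "c \<in> grid_cells K" and hull: "y \<in> convex hull (cell_corners p h c)"
    using assms(3) unfolding grid_covers_def by blast
  then have c: "c \<in> cells_meeting p h K A"
    using y unfolding cells_meeting_def by blast
  \<comment> \<open>\<open>infdist\<close> is 0 by convention on the empty set, hence the appeal to
    \<open>B \<noteq> {}\<close>.\<close>
  have "(INF z\<in>B. dist y z) = infdist y B"
    using assms(2) by (simp add: infdist_notempty)
  also have "\<dots> \<le> cell_bound p h A B c"
    using y hull by (rule infdist_le_cell_bound)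
  also have "\<dots> \<le> (MAX c \<in> cells_meeting p h K A. cell_bound p h A B c)"
    using c by (intro Max_ge) (auto simp: finite_cells_meeting)
  finally show "(INF z\<in>B. dist y z) \<le> (MAX c \<in> cells_meeting p h K A. cell_bound p h A B c)" .
qed

theorem theorem4:
  fixes A B :: "(real ^ 'n) set" and p :: "real ^ 'n" and h :: real and K :: "int ^ 'n"
  assumes "compact A" "A \<noteq> {}" "compact B" "B \<noteq> {}"
    and "h > 0" and "\<forall>i. K $ i \<ge> 1"
    and "grid_covers p h K (A \<union> B)"
  shows "directed_hausdorff A B \<le> (MAX c \<in> cells_meeting p h K A. cell_bound p h A B c)
    \<and> directed_hausdorff B A \<le> (MAX c \<in> cells_meeting p h K B. cell_bound p h B A c)
    \<and> hausdorff_dist A B \<le>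
        max (MAX c \<in> cells_meeting p h K A. cell_bound p h A B c)
            (MAX c \<in> cells_meeting p h K B. cell_bound p h B A c)"
proof -
  \<comment> \<open>Covering the union covers each set, so the one-sided bound applies in both
    directions.\<close>
  have "grid_covers p h K A" "grid_covers p h K B"
    using assms(7) unfolding grid_covers_def by blast+
  then have "directed_hausdorff A B \<le> (MAX c \<in> cells_meeting p h K A. cell_bound p h A B c)"
      "directed_hausdorff B A \<le> (MAX c \<in> cells_meeting p h K B. cell_bound p h B A c)"
    using assms(2,4) by (simp_all add: directed_hausdorff_le_Max_cell_bound)
  then show ?thesis
    unfolding hausdorff_dist_def by (auto intro: max.mono)
qed

end
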